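(* Let $(X,d,\preceq)$ be an ordered metric space, let $E$ be an $\overline{\mathrm O}$-complete subspace of $X$, and let $\ast\in\mathfrak B_n$. Let $F:X^n\to X$ and $g:X\to X$ be two mappings. Suppose that the following conditions hold: (i) $F(X^n)\subseteq g(X)\cap E$; (ii) $F$ has the $g$-monotone property; (iii) $F$ and $g$ are $(\ast,\overline{\mathrm O})$-compatible; (iv) $g$ is $\overline{\mathrm O}$-continuous; (v) either $F$ is $\overline{\mathrm O}$-continuous or $(E,d,\preceq)$ has the $g$-ICU property; (vi) there exist $x^{(0)}_1,\dots,x^{(0)}_n\in X$ such that $g(x^{(0)}_i)\preceq F(x^{(0)}_{i_1},x^{(0)}_{i_2},\dots,x^{(0)}_{i_n})$ for each $i\in I_n$; (vii) there exists $\varphi\in\Omega$ such that $$\frac1n\sum_{i=1}^n d\big(F(x_{i_1},\dots,x_{i_n}),F(y_{i_1},\dots,y_{i_n})\big)\le\varphi\Big(\frac1n\sum_{i=1}^n d(gx_i,gy_i)\Big)$$ for all $x_1,\dots,x_n,y_1,\dots,y_n\in X$ with [$g(x_i)\preceq g(y_i)$ for each $i\in I_n$] or [$g(x_i)\succeq g(y_i)$ for each $i\in I_n$]; or, alternatively to (vii), (vii$'$) there exists $\varphi\in\Omega$ such that $$\max_{i\in I_n} d\big(F(x_{i_1},\dots,x_{i_n}),F(y_{i_1},\dots,y_{i_n})\big)\le\varphi\Big(\max_{i\in I_n} d(gx_i,gy_i)\Big)$$ for all $x_1,\dots,x_n,y_1,\dots,y_n\in X$ with [$g(x_i)\preceq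 g(y_i)$ for each $i\in I_n$] or [$g(x_i)\succeq g(y_i)$ for each $i\in I_n$]. Then $F$ and $g$ have an $\ast$-coincidence point.
   Context: Throughout, $n\ge 2$ is a fixed integer, $I_n=\{1,\dots,n\}$, and sequences are indexed by $m\in\mathbb N_0$. An ordered metric space $(X,d,\preceq)$ is a nonempty set $X$ with a metric $d$ and a partial order $\preceq$; $x\succeq y$ means $y\preceq x$. A subspace is a nonempty subset with the restricted metric and order. We write $gx$ for $g(x)$. $\mathfrak B_n$ is the set of all binary operations $\ast:I_n\times I_n\to I_n$; for $\ast\in\mathfrak B_n$ write $i_k:=\ast(i,k)$. A sequence $\{x^{(m)}\}$ is increasing if $x^{(m)}\preceq x^{(m+1)}$ for all $m$. $x^{(m)}\uparrow x$ means that $\{x^{(m)}\}$ is increasing and converges to $x$ in $d$. $E$ is $\overline{\mathrm O}$-complete if every increasing Cauchy sequence in $E$ converges in $E$. $g$ is $\overline{\mathrm O}$-continuous if for every $x\in X$ and every sequence in $X$ with $x^{(m)}\uparrow x$ one has $g(x^{(m)})\to g(x)$. $F$ is $\overline{\mathrm O}$-continuous if for every $(x_1,\dots,x_n)\in X^n$ and all sequences $\{x_1^{(m)}\},\dots,\{x_n^{(m)}\}$ in $X$ with $x_i^{(m)}\uparrow x_i$ for each $i$, one has $F(x_1^{(m)},\dots,x_n^{(m)})\to F(x_1,\dots,x_n)$. $(E,d,\preceq)$ has the $g$-ICU property if for every sequence $\{x^{(m)}\}$ in $E$ and $x\in E$ with $x^{(m)}\uparrow x$, one has $g(x^{(m)})\preceq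 g(x)$ for all $m$. $F$ has the $g$-monotone property if, for all $x_1,\dots,x_n,y_1,\dots,y_n\in X$, $g(x_i)\preceq g(y_i)$ for all $i\in I_n$ implies $F(x_1,\dots,x_n)\preceq F(y_1,\dots,y_n)$. $F$ and $g$ are $(\ast,\overline{\mathrm O})$-compatible if for any sequences $\{x_1^{(m)}\},\dots,\{x_n^{(m)}\}$ in $X$ and any $z_1,\dots,z_n\in X$ with $g(x_i^{(m)})\uparrow z_i$ and $F(x_{i_1}^{(m)},\dots,x_{i_n}^{(m)})\uparrow z_i$ for each $i\in I_n$, one has $\lim_{m\to\infty}d\big(gF(x_{i_1}^{(m)},\dots,x_{i_n}^{(m)}),F(gx_{i_1}^{(m)},\dots,gx_{i_n}^{(m)})\big)=0$ for each $i\in I_n$. $\Omega$ is the set of functions $\varphi:[0,\infty)\to[0,\infty)$ with $\varphi(t)<t$ and $\limsup_{r\to t^+}\varphi(r)<t$ for each $t>0$. $(x_1,\dots,x_n)\in X^n$ is an $\ast$-coincidence point of $F$ and $g$ if $F(x_{i_1},\dots,x_{i_n})=g(x_i)$ for each $i\in I_n$. *)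

theory Defs
  imports "HOL-Analysis.Analysis"
begin

text \<open>
  An ordered metric space is a type of class \<open>metric_space\<close> and \<open>order\<close>; the two
  structures are unrelated. The finite index type \<open>'n\<close> plays the role of the index set
  \<open>{1,\<dots>,n}\<close>, so \<open>n\<close> is \<open>CARD('n)\<close>, an \<open>n\<close>-tuple is a function of type \<open>'n \<Rightarrow> 'a\<close>, and
  a binary operation on the index set has type \<open>'n \<Rightarrow> 'n \<Rightarrow> 'n\<close>.
\<close>

definition up_tendsto :: "(nat \<Rightarrow> 'a::{metric_space,order}) \<Rightarrow> 'a \<Rightarrow> bool"
    (infix "\<up>" 55) where
  "x \<up> l \<longleftrightarrow> incseq x \<and> x \<longlonglongrightarrow> l"

definition O_complete :: "'a::{metric_space,order} set \<Rightarrow> bool" where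
  "O_complete E \<longleftrightarrow>
     (\<forall>x. (\<forall>m. x m \<in> E) \<and> incseq x \<and> Cauchy x \<longrightarrow> (\<exists>l\<in>E. x \<longlonglongrightarrow> l))"

definition O_continuous :: "('a::{metric_space,order} \<Rightarrow> 'a) \<Rightarrow> bool" where
  "O_continuous g \<longleftrightarrow> (\<forall>x l. x \<up> l \<longrightarrow> (\<lambda>m. g (x m)) \<longlonglongrightarrow> g l)"

definition O_continuous_multi ::
    "(('n::finite \<Rightarrow> 'a::{metric_space,order}) \<Rightarrow> 'a) \<Rightarrow> bool" where
  "O_continuous_multi F \<longleftrightarrow>
     (\<forall>(x :: 'n \<Rightarrow> nat \<Rightarrow> 'a) l. (\<forall>i. x i \<up> l i) \<longrightarrow> (\<lambda>m. F (\<lambda>i. x i m)) \<longlonglongrightarrow> F l)"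

definition ICU_property ::
    "('a::{metric_space,order} \<Rightarrow> 'a) \<Rightarrow> 'a set \<Rightarrow> bool" where
  "ICU_property g E \<longleftrightarrow>
     (\<forall>x l. (\<forall>m. x m \<in> E) \<and> l \<in> E \<and> x \<up> l \<longrightarrow> (\<forall>m. g (x m) \<le> g l))"

definition g_monotone ::
    "(('n::finite \<Rightarrow> 'a::order) \<Rightarrow> 'a) \<Rightarrow> ('a \<Rightarrow> 'a) \<Rightarrow> bool" where
  "g_monotone F g \<longleftrightarrow> (\<forall>x y. (\<forall>i. g (x i) \<le> g (y i)) \<longrightarrow> F x \<le> F y)"

definition star_O_compatible ::
    "('n::finite \<Rightarrow> 'n \<Rightarrow> 'n) \<Rightarrow> (('n \<Rightarrow> 'a::{metric_space,order}) \<Rightarrow> 'a) \<Rightarrow> ('a \<Rightarrow> 'a) \<Rightarrow> bool"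
  where
  "star_O_compatible star F g \<longleftrightarrow>
     (\<forall>(x :: 'n \<Rightarrow> nat \<Rightarrow> 'a) z.
        (\<forall>i. (\<lambda>m. g (x i m)) \<up> z i \<and> (\<lambda>m. F (\<lambda>k. x (star i k) m)) \<up> z i) \<longrightarrow>
        (\<forall>i. (\<lambda>m. dist (g (F (\<lambda>k. x (star i k) m))) (F (\<lambda>k. g (x (star i k) m))))
               \<longlonglongrightarrow> 0))"

text \<open>
  Functions \<open>[0,\<infinity>) \<rightarrow> [0,\<infinity>)\<close> are represented by total functions on the reals whose values at
  negative arguments are irrelevant. The upper limit is taken in the extended reals, where
  it always exists.
\<close>

definition Omega :: "(real \<Rightarrow> real) set" where
  "Omega = {\<phi>. (\<forall>t\<ge>0. 0 \<le> \<phi> t) \<and>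
     (\<forall>t>0. \<phi> t < t \<and> Limsup (at_right t) (\<lambda>r. ereal (\<phi> r)) < ereal t)}"

definition star_coincidence_point ::
    "('n::finite \<Rightarrow> 'n \<Rightarrow> 'n) \<Rightarrow> (('n \<Rightarrow> 'a) \<Rightarrow> 'a) \<Rightarrow> ('a \<Rightarrow> 'a) \<Rightarrow> ('n \<Rightarrow> 'a) \<Rightarrow> bool" where
  "star_coincidence_point star F g x \<longleftrightarrow> (\<forall>i. F (\<lambda>k. x (star i k)) = g (x i))"

end

theory Submission imports Defs begin

text \<open>
  Write \<open>T x i = F (\<lambda>k. x (star i k))\<close> and \<open>G x i = g (x i)\<close>. A \<open>star\<close>-coincidence point is a
  tuple \<open>x\<close> with \<open>T x = G x\<close>, so the theorem concerns two self-maps of the product space, and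
  the averages and maxima in the contraction hypothesis are distances \<open>D\<close> on that product. All
  that is used of \<open>D\<close> is that it is a metric controlled from both sides by the
  coordinate distances; this is the locale \<open>tuple_distance\<close>, and the two alternatives of the
  contraction hypothesis become two instances of one argument.

  Since the range of \<open>F\<close> lies in that of \<open>g\<close>, there is a sequence with \<open>G x\<^sub>m\<^sub>+\<^sub>1 = T x\<^sub>m\<close>. By
  \<open>g\<close>-monotonicity the tuples \<open>y\<^sub>m = G x\<^sub>m\<close> increase in every coordinate, so any two of them
  are comparable and \<open>D y\<^sub>m\<^sub>+\<^sub>1 y\<^sub>n\<^sub>+\<^sub>1 \<le> \<phi> (D y\<^sub>m y\<^sub>n)\<close>. For \<open>\<phi> \<in> \<Omega>\<close> this forces \<open>y\<close> to be Cauchy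
  (\<open>contractive_imp_steps_tendsto_0\<close>, \<open>contractive_imp_Cauchy\<close>). The value \<open>\<phi> 0\<close> may be
  positive, and then the contraction hypothesis says nothing useful about tuples with
  \<open>G x = G y\<close>; but for these \<open>g\<close>-monotonicity and antisymmetry of the order give \<open>T x = T y\<close>.

  By completeness \<open>y\<^sub>m\<close> increases to a tuple \<open>z\<close> with entries in \<open>E\<close>. Continuity of \<open>g\<close> gives
  \<open>G y\<^sub>m \<longrightarrow> G z\<close>, and compatibility transfers this limit from
  \<open>G y\<^sub>m\<^sub>+\<^sub>1 = G (T x\<^sub>m)\<close> to \<open>T (G x\<^sub>m) = T y\<^sub>m\<close>. It remains to see that \<open>T y\<^sub>m \<longrightarrow> T z\<close>, as then
  \<open>T z = G z\<close>. If \<open>F\<close> is continuous along increasing sequences this is immediate. If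
  instead \<open>g\<close> has the ICU property, then \<open>G y\<^sub>m \<le> G z\<close>, so the contraction applies to \<open>y\<^sub>m\<close> and
  \<open>z\<close> and bounds \<open>D (T y\<^sub>m) (T z)\<close> by \<open>D (G y\<^sub>m) (G z)\<close>, which tends to \<open>0\<close>.
\<close>

section \<open>Contractive sequences\<close>

text \<open>
  The bound \<open>\<phi> t < t\<close> covers the point \<open>t\<close> and the bound on the upper limit covers a right
  neighbourhood of it. Together they leave a uniform gap below \<open>t\<close>, and this is the only form in
  which the upper limit enters the proof.
\<close>

lemma Omega_gap:
  assumes "\<phi> \<in> Omega" and "0 < t"
  obtains \<delta> s where "0 < \<delta>" "s < t" "\<And>r. t \<le> r \<Longrightarrow> r < t + \<delta> \<Longrightarrow> \<phi> r \<le> s"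
proof -
  have at_t: "\<phi> t < t" and lim: "Limsup (at_right t) (\<lambda>r. ereal (\<phi> r)) < ereal t"
    using assms by (auto simp: Omega_def)
  obtain u where u: "Limsup (at_right t) (\<lambda>r. ereal (\<phi> r)) < ereal u" "u < t"
    using ereal_dense2[OF lim] by auto
  have "eventually (\<lambda>r. ereal (\<phi> r) < ereal u) (at_right t)"
    using Limsup_lessD[OF u(1)] .
  then obtain b where b: "t < b" "\<And>r. t < r \<Longrightarrow> r < b \<Longrightarrow> \<phi> r < u"
    by (auto simp: eventually_at_right_field)
  show thesis
  proof (rule that[of "b - t" "max u (\<phi> t)"])
    fix r assume "t \<le> r" "r < t + (b - t)"
    then show "\<phi> r \<le> max u (\<phi> t)"
      using b(2)[of r] by (cases "r = t") auto
  qed (use b(1) u(2) at_t in auto)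
qed

text \<open>
  A positive limit \<open>L\<close> would be approached from above. Some \<open>d m\<close> would then lie where \<open>\<phi>\<close> leaves a
  gap below \<open>L\<close>, and the next term would already be smaller than \<open>L\<close>.
\<close>

lemma contractive_imp_steps_tendsto_0:
  fixes d :: "nat \<Rightarrow> real"
  assumes "\<phi> \<in> Omega"
    and nonneg: "\<And>m. 0 \<le> d m"
    and antimono: "\<And>m. d (Suc m) \<le> d m"
    and contr: "\<And>m. 0 < d m \<Longrightarrow> d (Suc m) \<le> \<phi> (d m)"
  shows "d \<longlonglongrightarrow> 0"
proof -
  have dec: "decseq d" using antimono by (rule decseq_SucI)
  obtain L where L: "d \<longlonglongrightarrow> L" "\<And>m. L \<le> d m"
    using decseq_convergent[OF dec, of 0] nonneg by auto
  have "L \<le> 0"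
  proof (rule ccontr)
    assume "\<not> L \<le> 0"
    then have "0 < L" by simp
    then obtain \<delta> s where gap: "0 < \<delta>" "s < L" "\<And>r. L \<le> r \<Longrightarrow> r < L + \<delta> \<Longrightarrow> \<phi> r \<le> s"
      using Omega_gap[OF assms(1)] by metis
    have "eventually (\<lambda>m. d m < L + \<delta>) sequentially"
      using order_tendstoD(2)[OF L(1)] gap(1) by simp
    then obtain m where "d m < L + \<delta>"
      by (auto simp: eventually_sequentially)
    then have "\<phi> (d m) \<le> s" using gap(3) L(2) by blast
    moreover have "d (Suc m) \<le> \<phi> (d m)"
      using contr[of m] \<open>0 < L\<close> L(2)[of m] by linarith
    ultimately show False using gap(2) L(2)[of "Suc m"] by linarith
  qed
  moreover have "0 \<le> L" using L(1) nonneg by (intro LIMSEQ_le_const) auto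
  ultimately show ?thesis using L(1) by simp
qed

text \<open>
  From some index on, the \<open>\<epsilon>\<close>-balls trap the sequence: by the triangle inequality one further
  step can take the distance at most into \<open>[\<epsilon>, \<epsilon> + \<delta>)\<close>, where \<open>\<phi>\<close> stays below some \<open>s < \<epsilon>\<close>, and
  there the contraction and two short steps bring it back below \<open>\<epsilon>\<close>.
\<close>

lemma contractive_imp_Cauchy:
  fixes D :: "'b \<Rightarrow> 'b \<Rightarrow> real" and y :: "nat \<Rightarrow> 'b"
  assumes "\<phi> \<in> Omega"
    and refl: "\<And>u. D u u = 0"
    and sym: "\<And>u v. D u v = D v u"
    and triangle: "\<And>u v w. D u w \<le> D u v + D v w"
    and steps: "(\<lambda>m. D (y m) (y (Suc m))) \<longlonglongrightarrow> 0"
    and contr: "\<And>m n. 0 < D (y m) (y n) \<Longrightarrow> D (y (Suc m)) (y (Suc n)) \<le> \<phi> (D (y m) (y n))"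
    and "0 < \<epsilon>"
  shows "\<exists>N. \<forall>m\<ge>N. \<forall>n\<ge>m. D (y m) (y n) < \<epsilon>"
proof -
  obtain \<delta> s where gap: "0 < \<delta>" "s < \<epsilon>" "\<And>r. \<epsilon> \<le> r \<Longrightarrow> r < \<epsilon> + \<delta> \<Longrightarrow> \<phi> r \<le> s"
    using Omega_gap[OF assms(1) \<open>0 < \<epsilon>\<close>] by metis
  define \<eta> where "\<eta> = min \<delta> ((\<epsilon> - s) / 2)"
  have "0 < \<eta>" using gap by (simp add: \<eta>_def)
  then have "eventually (\<lambda>m. D (y m) (y (Suc m)) < \<eta>) sequentially"
    using order_tendstoD(2)[OF steps] by blast
  then obtain N where N: "\<And>m. N \<le> m \<Longrightarrow> D (y m) (y (Suc m)) < \<eta>"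
    by (auto simp: eventually_sequentially)
  have "D (y m) (y n) < \<epsilon>" if "N \<le> m" "m \<le> n" for m n
    using \<open>m \<le> n\<close>
  proof (induction n rule: dec_induct)
    case base
    show ?case using refl \<open>0 < \<epsilon>\<close> by simp
  next
    case (step n)
    show ?case
    proof (rule ccontr)
      let ?r = "D (y m) (y (Suc n))"
      assume "\<not> ?r < \<epsilon>"
      then have "\<epsilon> \<le> ?r" by simp
      moreover have "?r < \<epsilon> + \<delta>"
        using triangle[of "y m" "y (Suc n)" "y n"] step.IH N[of n] \<open>N \<le> m\<close> step.hyps
        by (simp add: \<eta>_def)
      ultimately have "\<phi> ?r \<le> s" using gap(3) by blast
      moreover have "D (y (Suc m)) (y (Suc (Suc n))) \<le> \<phi> ?r"
        using contr \<open>\<epsilon> \<le> ?r\<close> \<open>0 < \<epsilon>\<close> by simp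
      moreover have "?r \<le> D (y m) (y (Suc m)) + D (y (Suc m)) (y (Suc (Suc n)))
                         + D (y (Suc n)) (y (Suc (Suc n)))"
        using triangle[of "y m" "y (Suc n)" "y (Suc m)"]
          triangle[of "y (Suc m)" "y (Suc n)" "y (Suc (Suc n))"]
          sym[of "y (Suc n)" "y (Suc (Suc n))"] by linarith
      moreover have "2 * D (y m) (y (Suc m)) < \<epsilon> - s"
        "2 * D (y (Suc n)) (y (Suc (Suc n))) < \<epsilon> - s"
        using N[of m] N[of "Suc n"] \<open>N \<le> m\<close> step.hyps by (auto simp: \<eta>_def)
      ultimately show False using \<open>\<epsilon> \<le> ?r\<close> by linarith
    qed
  qed
  then show ?thesis by blast
qed

section \<open>Distances on tuples\<close>

text \<open>
  The lower bound makes \<open>D\<close>-Cauchy tuples Cauchy in each coordinate, and the upper bound turns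
  coordinatewise convergence into \<open>D\<close>-convergence.
\<close>

locale tuple_distance =
  fixes D :: "('n::finite \<Rightarrow> 'a::{metric_space,order}) \<Rightarrow> ('n \<Rightarrow> 'a) \<Rightarrow> real" and C :: real
  assumes D_refl: "D u u = 0"
    and D_sym: "D u v = D v u"
    and D_triangle: "D u w \<le> D u v + D v w"
    and C_pos: "0 < C"
    and dist_le_D: "dist (u i) (v i) \<le> C * D u v"
    and D_le_sum: "D u v \<le> (\<Sum>i\<in>UNIV. dist (u i) (v i))"
begin

lemma D_nonneg: "0 \<le> D u v"
  using D_refl[of u] D_triangle[of u u v] D_sym[of u v] by linarith

lemma D_eq_0_imp_eq: "D u v = 0 \<Longrightarrow> u i = v i"
  using dist_le_D[of u i v] by simp

lemma D_tendsto_0: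
  assumes "\<And>i. (\<lambda>m. u m i) \<longlonglongrightarrow> v i"
  shows "(\<lambda>m. D (u m) v) \<longlonglongrightarrow> 0"
proof (rule tendsto_sandwich[OF _ _ tendsto_const])
  have "(\<lambda>m. \<Sum>i\<in>UNIV. dist (u m i) (v i)) \<longlonglongrightarrow> (\<Sum>i\<in>(UNIV :: 'n set). 0)"
    using assms by (intro tendsto_sum tendsto_dist_iff[THEN iffD1])
  then show "(\<lambda>m. \<Sum>i\<in>UNIV. dist (u m i) (v i)) \<longlonglongrightarrow> 0" by simp
qed (auto simp: D_nonneg D_le_sum)

lemma tendsto_if_D_tendsto_0:
  assumes "(\<lambda>m. D (u m) v) \<longlonglongrightarrow> 0"
  shows "(\<lambda>m. u m i) \<longlonglongrightarrow> v i"
proof -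
  have "(\<lambda>m. C * D (u m) v) \<longlonglongrightarrow> 0"
    using tendsto_mult_left[OF assms, of C] by simp
  then have "(\<lambda>m. dist (u m i) (v i)) \<longlonglongrightarrow> 0"
    by (rule tendsto_sandwich[OF _ _ tendsto_const, rotated 2]) (auto simp: dist_le_D)
  then show ?thesis by (rule tendsto_dist_iff[THEN iffD2])
qed

lemma Cauchy_component:
  assumes "\<And>\<epsilon>. 0 < \<epsilon> \<Longrightarrow> \<exists>N. \<forall>m\<ge>N. \<forall>n\<ge>m. D (y m) (y n) < \<epsilon>"
  shows "Cauchy (\<lambda>m. y m i)"
proof (rule CauchyI')
  fix \<epsilon> :: real assume "0 < \<epsilon>"
  then obtain N where N: "\<And>m n. N \<le> m \<Longrightarrow> m \<le> n \<Longrightarrow> D (y m) (y n) < \<epsilon> / C"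
    using assms[of "\<epsilon> / C"] C_pos by auto
  have "dist (y m i) (y n i) < \<epsilon>" if "N \<le> m" "m < n" for m n
    using N[of m n] that dist_le_D[of "y m" i "y n"] C_pos by (simp add: field_simps)
  then show "\<exists>N. \<forall>m\<ge>N. \<forall>n>m. dist (y m i) (y n i) < \<epsilon>" by blast
qed

end

lemma tuple_distance_average:
  "tuple_distance
     (\<lambda>u v :: 'n::finite \<Rightarrow> 'a::{metric_space,order}.
        1 / real CARD('n) * (\<Sum>i\<in>UNIV. dist (u i) (v i))) (real CARD('n))"
proof
  fix u v w :: "'n \<Rightarrow> 'a" and i :: 'n
  have "(\<Sum>i\<in>UNIV. dist (u i) (w i))
      \<le> (\<Sum>i\<in>UNIV. dist (u i) (v i)) + (\<Sum>i\<in>UNIV. dist (v i) (w i))"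
    unfolding sum.distrib[symmetric] by (intro sum_mono dist_triangle)
  then show "1 / real CARD('n) * (\<Sum>i\<in>UNIV. dist (u i) (w i))
    \<le> 1 / real CARD('n) * (\<Sum>i\<in>UNIV. dist (u i) (v i))
      + 1 / real CARD('n) * (\<Sum>i\<in>UNIV. dist (v i) (w i))"
    unfolding distrib_left[symmetric] by (intro mult_left_mono) auto
  show "dist (u i) (v i)
      \<le> real CARD('n) * (1 / real CARD('n) * (\<Sum>i\<in>UNIV. dist (u i) (v i)))"
    using member_le_sum[of i UNIV "\<lambda>i. dist (u i) (v i)"] by simp
  have "(\<Sum>i\<in>UNIV. dist (u i) (v i)) * 1 \<le> (\<Sum>i\<in>UNIV. dist (u i) (v i)) * real CARD('n)"
    by (intro mult_left_mono) (auto simp: sum_nonneg Suc_le_eq)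
  then show "1 / real CARD('n) * (\<Sum>i\<in>UNIV. dist (u i) (v i)) \<le> (\<Sum>i\<in>UNIV. dist (u i) (v i))"
    by (simp add: field_simps)
qed (simp_all add: dist_commute)

lemma tuple_distance_maximum:
  "tuple_distance
     (\<lambda>u v :: 'n::finite \<Rightarrow> 'a::{metric_space,order}. MAX i. dist (u i) (v i)) 1"
proof
  fix u v w :: "'n \<Rightarrow> 'a" and i :: 'n
  have le_max: "dist (u i) (v i) \<le> (MAX i. dist (u i) (v i))" for u v :: "'n \<Rightarrow> 'a" and i
    by (intro Max_ge) auto
  show "dist (u i) (v i) \<le> 1 * (MAX i. dist (u i) (v i))" using le_max by simp
  show "(MAX i. dist (u i) (w i)) \<le> (MAX i. dist (u i) (v i)) + (MAX i. dist (v i) (w i))"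
  proof -
    have "dist (u i) (w i) \<le> (MAX i. dist (u i) (v i)) + (MAX i. dist (v i) (w i))" for i
      using dist_triangle[of "u i" "w i" "v i"] le_max[of u i v] le_max[of v i w] by linarith
    then show ?thesis by simp
  qed
  show "(MAX i. dist (u i) (v i)) \<le> (\<Sum>i\<in>UNIV. dist (u i) (v i))"
    by (auto intro!: member_le_sum)
qed (simp_all add: dist_commute)

section \<open>Coincidence points\<close>

text \<open>
  If \<open>\<phi> 0 > 0\<close>, the contraction hypothesis does not force \<open>D (T x) (T y) = 0\<close> when
  \<open>D (G x) (G y) = 0\<close>. In that case \<open>G x = G y\<close>, and the monotonicity of \<open>F\<close> applies in both
  directions.
\<close>

lemma (in tuple_distance) nonexpansive_if_contraction:
  assumes "\<phi> \<in> Omega" and "g_monotone F g"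
    and le: "\<And>i. g (x i) \<le> g (y i)"
    and contr: "D (\<lambda>i. F (\<lambda>k. x (star i k))) (\<lambda>i. F (\<lambda>k. y (star i k)))
                  \<le> \<phi> (D (\<lambda>i. g (x i)) (\<lambda>i. g (y i)))"
  shows "D (\<lambda>i. F (\<lambda>k. x (star i k))) (\<lambda>i. F (\<lambda>k. y (star i k)))
           \<le> D (\<lambda>i. g (x i)) (\<lambda>i. g (y i))"
proof (cases "D (\<lambda>i. g (x i)) (\<lambda>i. g (y i)) = 0")
  case True
  then have "g (x i) = g (y i)" for i
    using D_eq_0_imp_eq[of "\<lambda>i. g (x i)" "\<lambda>i. g (y i)"] by blast
  then have "F (\<lambda>k. x (star i k)) = F (\<lambda>k. y (star i k))" for i
    using \<open>g_monotone F g\<close> by (intro antisym) (simp_all add: g_monotone_def)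
  then show ?thesis using True D_refl by simp
next
  case False
  then have "0 < D (\<lambda>i. g (x i)) (\<lambda>i. g (y i))"
    using D_nonneg by (simp add: less_le)
  then show ?thesis using contr \<open>\<phi> \<in> Omega\<close> by (force simp: Omega_def)
qed

lemma (in tuple_distance) coincidence_point_if_contraction:
  assumes complete: "O_complete E"
    and range: "range F \<subseteq> range g \<inter> E"
    and mono: "g_monotone F g"
    and compatible: "star_O_compatible star F g"
    and g_cont: "O_continuous g"
    and F_cont_or_ICU: "O_continuous_multi F \<or> ICU_property g E"
    and start: "\<And>i. g (x0 i) \<le> F (\<lambda>k. x0 (star i k))"
    and "\<phi> \<in> Omega"
    and contr: "\<And>x y. (\<And>i. g (x i) \<le> g (y i)) \<Longrightarrow>
        D (\<lambda>i. F (\<lambda>k. x (star i k))) (\<lambda>i. F (\<lambda>k. y (star i k)))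
          \<le> \<phi> (D (\<lambda>i. g (x i)) (\<lambda>i. g (y i)))"
  shows "\<exists>x. star_coincidence_point star F g x"
proof -
  define T where "T x = (\<lambda>i. F (\<lambda>k. x (star i k)))" for x
  define G where "G x = (\<lambda>i. g (x i))" for x :: "'n \<Rightarrow> 'a"
  have contr: "D (T x) (T y) \<le> \<phi> (D (G x) (G y))"
    and nonexp: "D (T x) (T y) \<le> D (G x) (G y)" if "\<And>i. G x i \<le> G y i" for x y
    using contr[of x y] nonexpansive_if_contraction[OF \<open>\<phi> \<in> Omega\<close> mono, of x y star] that
    unfolding T_def G_def by blast+
  have T_mono: "T x i \<le> T y i" if "\<And>i. G x i \<le> G y i" for x y i
    using mono that by (simp add: T_def G_def g_monotone_def)
  have T_E: "T x i \<in> E" for x i using range by (auto simp: T_def)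

  define next_x where "next_x x = (\<lambda>i. inv g (T x i))" for x
  have next_x: "G (next_x x) = T x" for x
  proof
    fix i
    have "T x i \<in> range g" using range unfolding T_def by blast
    then show "G (next_x x) i = T x i"
      unfolding G_def next_x_def by (rule f_inv_into_f)
  qed
  define x where "x = rec_nat x0 (\<lambda>_. next_x)"
  have x_0: "x 0 = x0" and x_Suc: "G (x (Suc m)) = T (x m)" for m
    by (simp_all add: x_def next_x)
  define y where "y m = G (x m)" for m
  have y_Suc: "y (Suc m) = T (x m)" for m by (simp add: y_def x_Suc)
  have y_E: "y (Suc m) i \<in> E" for m i by (simp add: y_Suc T_E)

  have "y m i \<le> y (Suc m) i" for m i
  proof (induction m arbitrary: i)
    case 0
    show ?case using start by (simp add: y_Suc) (simp add: y_def x_0 G_def T_def)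
  next
    case (Suc m)
    have "T (x m) i \<le> T (x (Suc m)) i" by (rule T_mono) (use Suc in \<open>simp add: y_def\<close>)
    then show ?case by (simp add: y_Suc)
  qed
  then have y_inc: "incseq (\<lambda>m. y m i)" for i by (rule incseq_SucI)

  \<comment> \<open>For \<open>m \<le> n\<close> the tuples \<open>G (x m)\<close>, \<open>G (x n)\<close> are ordered and the contraction
      applies; symmetry of \<open>D\<close> then gives the bound for all \<open>m\<close>, \<open>n\<close>.\<close>
  have y_contr_le: "D (y (Suc m)) (y (Suc n)) \<le> \<phi> (D (y m) (y n))"
    and y_nonexp: "D (y (Suc m)) (y (Suc n)) \<le> D (y m) (y n)" if "m \<le> n" for m n
  proof -
    have "G (x m) i \<le> G (x n) i" for i
      using incseqD[OF y_inc \<open>m \<le> n\<close>] by (simp add: y_def)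
    then show "D (y (Suc m)) (y (Suc n)) \<le> \<phi> (D (y m) (y n))"
      "D (y (Suc m)) (y (Suc n)) \<le> D (y m) (y n)"
      using contr[of "x m" "x n"] nonexp[of "x m" "x n"]
      by (simp_all add: y_Suc y_def[of m] y_def[of n])
  qed
  have y_contr: "D (y (Suc m)) (y (Suc n)) \<le> \<phi> (D (y m) (y n))" for m n
    using y_contr_le[of m n] y_contr_le[of n m] D_sym by (metis nle_le)
  have steps: "(\<lambda>m. D (y m) (y (Suc m))) \<longlonglongrightarrow> 0"
    by (rule contractive_imp_steps_tendsto_0[OF \<open>\<phi> \<in> Omega\<close>])
      (simp_all add: D_nonneg y_nonexp y_contr)
  have "\<exists>N. \<forall>m\<ge>N. \<forall>n\<ge>m. D (y m) (y n) < \<epsilon>" if "0 < \<epsilon>" for \<epsilon>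
    by (rule contractive_imp_Cauchy[where D = D, OF \<open>\<phi> \<in> Omega\<close> D_refl D_sym D_triangle
          steps y_contr that])
  then have y_Cauchy: "Cauchy (\<lambda>m. y m i)" for i by (rule Cauchy_component)

  have "\<exists>l\<in>E. (\<lambda>m. y m i) \<longlonglongrightarrow> l" for i
  proof -
    \<comment> \<open>Only the entries from index \<open>1\<close> on are values of \<open>F\<close> and hence in \<open>E\<close>.\<close>
    have "incseq (\<lambda>m. y (Suc m) i)"
      using y_inc[of i] by (simp add: incseq_Suc_iff)
    moreover have "Cauchy (\<lambda>m. y (Suc m) i)"
      using Cauchy_subseq_Cauchy[OF y_Cauchy[of i], of Suc]
      by (simp add: strict_mono_Suc_iff o_def)
    ultimately obtain l where "l \<in> E" "(\<lambda>m. y (Suc m) i) \<longlonglongrightarrow> l"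
      using complete[unfolded O_complete_def, rule_format, of "\<lambda>m. y (Suc m) i"] y_E by metis
    then show ?thesis by (auto simp: filterlim_sequentially_Suc[of "\<lambda>m. y m i"])
  qed
  then obtain z where z_E: "\<And>i. z i \<in> E" and y_lim: "\<And>i. (\<lambda>m. y m i) \<longlonglongrightarrow> z i"
    by metis
  have y_up: "(\<lambda>m. y m i) \<up> z i" for i
    using y_inc y_lim by (simp add: up_tendsto_def)
  have y_Suc_up: "(\<lambda>m. y (Suc m) i) \<up> z i" for i
    using y_inc[of i] LIMSEQ_Suc[OF y_lim[of i]] by (simp add: up_tendsto_def incseq_Suc_iff)

  have Gy_lim: "(\<lambda>m. G (y m) i) \<longlonglongrightarrow> G z i" for i
    using g_cont y_up[of i] by (simp add: O_continuous_def G_def)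
  have Ty_lim: "(\<lambda>m. T (y m) i) \<longlonglongrightarrow> G z i" for i
  proof -
    have "(\<lambda>m. g (x m i)) \<up> z i \<and> (\<lambda>m. F (\<lambda>k. x m (star i k))) \<up> z i" for i
      using y_up[of i] y_Suc_up[of i] unfolding y_Suc by (simp add: y_def G_def T_def)
    then have "(\<lambda>m. dist (g (F (\<lambda>k. x m (star i k)))) (F (\<lambda>k. g (x m (star i k))))) \<longlonglongrightarrow> 0"
      using compatible[unfolded star_O_compatible_def, rule_format, of "\<lambda>i m. x m i" z i] by blast
    moreover have "G (y (Suc m)) i = g (F (\<lambda>k. x m (star i k)))"
      "T (y m) i = F (\<lambda>k. g (x m (star i k)))" for m
      unfolding y_Suc by (simp_all add: y_def G_def T_def)
    ultimately have "(\<lambda>m. dist (G (y (Suc m)) i) (T (y m) i)) \<longlonglongrightarrow> 0"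
      by simp
    moreover have "(\<lambda>m. dist (G (y (Suc m)) i) (G z i)) \<longlonglongrightarrow> 0"
      by (rule tendsto_dist_iff[THEN iffD1, OF LIMSEQ_Suc[OF Gy_lim]])
    ultimately have "(\<lambda>m. dist (G (y (Suc m)) i) (T (y m) i)
                        + dist (G (y (Suc m)) i) (G z i)) \<longlonglongrightarrow> 0"
      by (rule tendsto_add_zero)
    then have "(\<lambda>m. dist (T (y m) i) (G z i)) \<longlonglongrightarrow> 0"
      by (rule tendsto_sandwich[OF _ _ tendsto_const, rotated 2]) (auto simp: dist_triangle3)
    then show ?thesis by (rule tendsto_dist_iff[THEN iffD2])
  qed

  have "(\<lambda>m. T (y m) i) \<longlonglongrightarrow> T z i" for i
    using F_cont_or_ICU
  proof
    assume "O_continuous_multi F"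
    then show ?thesis
      using y_up unfolding O_continuous_multi_def T_def
      by (elim allE[where x = "\<lambda>k m. y m (star i k)"]
          allE[where x = "\<lambda>k. z (star i k)"]) simp
  next
    assume ICU: "ICU_property g E"
    have "G (y (Suc m)) i \<le> G z i" for m i
      using ICU[unfolded ICU_property_def, rule_format, of "\<lambda>m. y (Suc m) i" "z i" m]
        y_E z_E y_Suc_up by (simp add: G_def)
    then have bound: "D (T (y (Suc m))) (T z) \<le> D (G (y (Suc m))) (G z)" for m
      by (rule nonexp)
    have "(\<lambda>m. D (G (y (Suc m))) (G z)) \<longlonglongrightarrow> 0"
      by (rule D_tendsto_0) (rule LIMSEQ_Suc[OF Gy_lim])
    then have "(\<lambda>m. D (T (y (Suc m))) (T z)) \<longlonglongrightarrow> 0"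
      by (rule tendsto_sandwich[OF _ _ tendsto_const, rotated 2]) (auto simp: D_nonneg bound)
    then have "(\<lambda>m. T (y (Suc m)) i) \<longlonglongrightarrow> T z i" by (rule tendsto_if_D_tendsto_0)
    then show ?thesis by (simp add: filterlim_sequentially_Suc[of "\<lambda>m. T (y m) i"])
  qed
  then have "T z i = G z i" for i using Ty_lim LIMSEQ_unique by blast
  then show ?thesis unfolding star_coincidence_point_def T_def G_def by blast
qed

theorem theorem1:
  fixes E :: "'a::{metric_space,order} set"
    and star :: "'n::finite \<Rightarrow> 'n \<Rightarrow> 'n"
    and F :: "('n \<Rightarrow> 'a) \<Rightarrow> 'a"
    and g :: "'a \<Rightarrow> 'a"
  assumes "CARD('n) \<ge> 2"
    and "E \<noteq> {}"
    and "O_complete E"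
    and "range F \<subseteq> range g \<inter> E"
    and "g_monotone F g"
    and "star_O_compatible star F g"
    and "O_continuous g"
    and "O_continuous_multi F \<or> ICU_property g E"
    and "\<exists>x0. \<forall>i. g (x0 i) \<le> F (\<lambda>k. x0 (star i k))"
    and "(\<exists>\<phi>\<in>Omega. \<forall>x y.
            (\<forall>i. g (x i) \<le> g (y i)) \<or> (\<forall>i. g (x i) \<ge> g (y i)) \<longrightarrow>
            1 / real CARD('n) * (\<Sum>i\<in>UNIV. dist (F (\<lambda>k. x (star i k))) (F (\<lambda>k. y (star i k))))
              \<le> \<phi> (1 / real CARD('n) * (\<Sum>i\<in>UNIV. dist (g (x i)) (g (y i)))))
       \<or> (\<exists>\<phi>\<in>Omega. \<forall>x y.
            (\<forall>i. g (x i) \<le> g (y i)) \<or> (\<forall>i. g (x i) \<ge> g (y i)) \<longrightarrow>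
            (MAX i. dist (F (\<lambda>k. x (star i k))) (F (\<lambda>k. y (star i k))))
              \<le> \<phi> (MAX i. dist (g (x i)) (g (y i))))"
  shows "\<exists>x. star_coincidence_point star F g x"
proof -
  obtain x0 where x0: "\<And>i. g (x0 i) \<le> F (\<lambda>k. x0 (star i k))" using assms(9) by blast
  from assms(10) show ?thesis
  proof (elim disjE bexE)
    fix \<phi>
    assume "\<phi> \<in> Omega" and *: "\<forall>x y.
        (\<forall>i. g (x i) \<le> g (y i)) \<or> (\<forall>i. g (x i) \<ge> g (y i)) \<longrightarrow>
        1 / real CARD('n) * (\<Sum>i\<in>UNIV. dist (F (\<lambda>k. x (star i k))) (F (\<lambda>k. y (star i k))))
          \<le> \<phi> (1 / real CARD('n) * (\<Sum>i\<in>UNIV. dist (g (x i)) (g (y i))))"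
    show ?thesis
      by (rule tuple_distance.coincidence_point_if_contraction
            [OF tuple_distance_average assms(3-8) x0 \<open>\<phi> \<in> Omega\<close>])
        (use * in blast)
  next
    fix \<phi>
    assume "\<phi> \<in> Omega" and *: "\<forall>x y.
        (\<forall>i. g (x i) \<le> g (y i)) \<or> (\<forall>i. g (x i) \<ge> g (y i)) \<longrightarrow>
        (MAX i. dist (F (\<lambda>k. x (star i k))) (F (\<lambda>k. y (star i k))))
          \<le> \<phi> (MAX i. dist (g (x i)) (g (y i)))"
    show ?thesis
      by (rule tuple_distance.coincidence_point_if_contraction
            [OF tuple_distance_maximum assms(3-8) x0 \<open>\<phi> \<in> Omega\<close>])
        (use * in blast)
  qed
qed

end
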